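(* Consider a time-homogeneous absorbing discrete-time Markov chain on the finite state space $\Omega=\{1,\dots,|\Omega|\}$ with transition matrix $P=\begin{bmatrix} Q & R\\ 0 & I\end{bmatrix}$ in canonical form (transient states first), and impulse-reward matrix $\Theta=\begin{bmatrix}\Theta_1 & \Theta_2\\ 0 & 0\end{bmatrix}$. Let $H=\Theta\odot P=\begin{bmatrix} H_1 & H_2\\ 0&0\end{bmatrix}$ and $N=(I-Q)^{-1}$. Let $\hat R_n$ be the $|\Omega|\times|\Omega|$ matrix with entries $\hat R_n(i,j)$. Then for every $n=1,2,\dots$, $$\hat R_n=\begin{bmatrix}A_n & B_n\\ 0&0\end{bmatrix},$$ where $$A_n=\sum_{i=0}^{n-1}Q^{i}H_1Q^{n-i-1},\qquad B_n=N(I-Q^{n})H_2+N(I-Q^{n-1})H_1NR-\sum_{i=0}^{n-2}Q^{i}H_1NQ^{n-i-1}R.$$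
   Context: Let $S_0,S_1,\dots$ be a time-homogeneous Markov chain on a finite state space $\Omega=\{1,\dots,|\Omega|\}$ with transition probabilities $p_{ij}=\Pr(S_n=j\mid S_{n-1}=i)$ and transition matrix $P=(p_{ij})$. A state $i$ is absorbing if $p_{ii}=1$ (so $p_{ij}=0$ for $j\ne i$), and is transient otherwise. The chain is absorbing: there is at least one absorbing state, and from every transient state some absorbing state can be reached in finitely many transitions. Let $\Omega_T$ and $\Omega_A$ be the sets of transient and absorbing states; transient states have lower indices than absorbing states, so $P=\begin{bmatrix} Q & R\\ 0 & I\end{bmatrix}$ with $Q$ of size $|\Omega_T|\times|\Omega_T|$ and $R$ of size $|\Omega_T|\times|\Omega_A|$. The matrix $I-Q$ is invertible and $N=(I-Q)^{-1}$ is called the fundamental matrix. By convention $Q^0=I$ and empty sums are $0$. The impulse-reward matrix $\Theta=(\rho_{ij})$ is a real $|\Omega|\times|\Omega|$ matrix, $\rho_{ij}$ being the reward accumulated on a transition from $i$ to $j$. Transitions out of absorbing states carry zero reward, so $\Theta=\begin{bmatrix}\Theta_1 & \Theta_2\\ 0&0\end{bmatrix}$ with $\Theta_1$ of size $|\Omega_T|\times|\Omega_T|$ and $\Theta_2$ of size $|\Omega_T|\times|\Omega_A|$. $H=\Theta\odot P$ is the entrywise (Hadamard) product, $H(i,j)=\rho_{ij}p_{ij}$, with blocks $H_1,H_2$ partitioned in the same way. The accumulated reward at time $n\ge1$ is the random variable $R_n=\sum_{k=1}^{n}\rho_{S_{k-1}S_k}$ (not to be confused with the matrix $R$). Set $\bar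 R_n(i,j)=\mathbb E(R_n\mid S_0=i,S_n=j)$ and $\hat R_n(i,j)=\bar R_n(i,j)\cdot\Pr(S_n=j\mid S_0=i)$, with $\hat R_n(i,j)=0$ when $\Pr(S_n=j\mid S_0=i)=0$. *)

theory Defs
  imports "HOL-Probability.Probability" "Jordan_Normal_Form.Gauss_Jordan_Elimination"
begin

text \<open>
  Matrices are those of \<^theory>\<open>Jordan_Normal_Form.Matrix\<close>, so that the numbers of transient and
  absorbing states are ordinary natural numbers and \<^const>\<open>four_block_mat\<close> is available. States
  are numbered from \<open>0\<close>: the state space of a chain with transition matrix \<open>P\<close> is
  \<open>{0..<dim_row P}\<close>.
\<close>

definition hadamard_mat :: "real mat \<Rightarrow> real mat \<Rightarrow> real mat" (infixl \<open>\<odot>\<close> 70) where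
  "A \<odot> B = Matrix.mat (dim_row A) (dim_col A) (\<lambda>(i, j). A $$ (i, j) * B $$ (i, j))"

text \<open>
  Matrices of all dimensions share one type, which therefore has no zero and no \<^const>\<open>sum\<close>;
  the dimensions of a (possibly empty) matrix sum are given explicitly.
\<close>

definition mat_sum :: "nat \<Rightarrow> nat \<Rightarrow> (nat \<Rightarrow> real mat) \<Rightarrow> nat set \<Rightarrow> real mat" where
  "mat_sum nr nc F K = Matrix.mat nr nc (\<lambda>ij. \<Sum>k\<in>K. F k $$ ij)"

definition transition_matrix :: "real mat \<Rightarrow> bool" where
  "transition_matrix P \<longleftrightarrow> square_mat P \<and>
     (\<forall>i<dim_row P. (\<forall>j<dim_row P. 0 \<le> P $$ (i, j)) \<and> (\<Sum>j<dim_row P. P $$ (i, j)) = 1)"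

definition absorbing_states :: "real mat \<Rightarrow> nat set" where
  "absorbing_states P = {i \<in> {0..<dim_row P}. P $$ (i, i) = 1}"

definition transient_states :: "real mat \<Rightarrow> nat set" where
  "transient_states P = {0..<dim_row P} - absorbing_states P"

definition transitions :: "real mat \<Rightarrow> (nat \<times> nat) set" where
  "transitions P = {(i, j). i < dim_row P \<and> j < dim_row P \<and> 0 < P $$ (i, j)}"

definition absorbing_chain :: "real mat \<Rightarrow> bool" where
  "absorbing_chain P \<longleftrightarrow> transition_matrix P \<and> absorbing_states P \<noteq> {} \<and>
     (\<forall>i\<in>transient_states P. \<exists>j\<in>absorbing_states P. (i, j) \<in> (transitions P)\<^sup>*)"

text \<open>
  \<^const>\<open>mat_inverse\<close> returns an option; for the transient block \<open>Q\<close> of an absorbing chain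
  \<open>I - Q\<close> is invertible, so the value is \<open>Some\<close> of the inverse.
\<close>

definition fundamental_matrix :: "real mat \<Rightarrow> real mat" where
  "fundamental_matrix Q = the (mat_inverse (1\<^sub>m (dim_row Q) - Q))"

text \<open>
  The last two clauses are the Markov property and time-homogeneity with transition probabilities
  \<open>P\<close>; each is required where the conditioning event has positive probability. The initial
  distribution is arbitrary.
\<close>

definition markov_chain :: "'w measure \<Rightarrow> (nat \<Rightarrow> 'w \<Rightarrow> nat) \<Rightarrow> real mat \<Rightarrow> bool" where
  "markov_chain M S P \<longleftrightarrow> prob_space M \<and>
     (\<forall>n. S n \<in> measurable M (count_space {0..<dim_row P})) \<and>
     (\<forall>n x j. \<P>(\<omega> in M. \<forall>k\<le>n. S k \<omega> = x k) > 0 \<longrightarrow>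
        \<P>(\<omega> in M. S (Suc n) \<omega> = j \<bar> \<forall>k\<le>n. S k \<omega> = x k)
          = \<P>(\<omega> in M. S (Suc n) \<omega> = j \<bar> S n \<omega> = x n)) \<and>
     (\<forall>n. \<forall>i<dim_row P. \<forall>j<dim_row P. \<P>(\<omega> in M. S n \<omega> = i) > 0 \<longrightarrow>
        \<P>(\<omega> in M. S (Suc n) \<omega> = j \<bar> S n \<omega> = i) = P $$ (i, j))"

definition accumulated_reward ::
    "real mat \<Rightarrow> (nat \<Rightarrow> 'w \<Rightarrow> nat) \<Rightarrow> nat \<Rightarrow> 'w \<Rightarrow> real" where
  "accumulated_reward \<Theta> S n \<omega> = (\<Sum>k=1..n. \<Theta> $$ (S (k - 1) \<omega>, S k \<omega>))"

text \<open>
  Elementary conditional expectation given an event \<open>A\<close> of positive probability: expectation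
  under the conditional law \<open>B \<mapsto> Pr (A \<inter> B) / Pr A\<close>.
\<close>

definition cond_expectation :: "'w measure \<Rightarrow> ('w \<Rightarrow> real) \<Rightarrow> 'w set \<Rightarrow> real" where
  "cond_expectation M X A = (\<integral>\<omega>. X \<omega> \<partial>uniform_measure M A)"

text \<open>
  Quantities conditional on \<open>S\<^sub>0 = i\<close> need a law under which \<open>S\<^sub>0 = i\<close> has positive probability.
  The chain therefore comes with a family \<open>M\<close> of laws, \<open>M i\<close> serving for the initial state \<open>i\<close>.
  It may be a constant family (one initial distribution charging every state) or the usual family
  of laws of the chain started at \<open>i\<close>.
\<close>

definition mean_reward ::
    "(nat \<Rightarrow> 'w measure) \<Rightarrow> (nat \<Rightarrow> 'w \<Rightarrow> nat) \<Rightarrow> real mat \<Rightarrow> nat \<Rightarrow> nat \<Rightarrow> nat \<Rightarrow> real" where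
  "mean_reward M S \<Theta> n i j =
     cond_expectation (M i) (accumulated_reward \<Theta> S n)
       {\<omega> \<in> space (M i). S 0 \<omega> = i \<and> S n \<omega> = j}"

definition weighted_reward_mat ::
    "(nat \<Rightarrow> 'w measure) \<Rightarrow> (nat \<Rightarrow> 'w \<Rightarrow> nat) \<Rightarrow> real mat \<Rightarrow> nat \<Rightarrow> real mat" where
  "weighted_reward_mat M S \<Theta> n = Matrix.mat (dim_row \<Theta>) (dim_col \<Theta>) (\<lambda>(i, j).
     if \<P>(\<omega> in M i. S n \<omega> = j \<bar> S 0 \<omega> = i) = 0 then 0
     else mean_reward M S \<Theta> n i j * \<P>(\<omega> in M i. S n \<omega> = j \<bar> S 0 \<omega> = i))"

end

theory Submission
  imports Defs "Jordan_Normal_Form.Determinant"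
begin

text \<open>
  Conditioning on the history up to time \<open>n\<close> shows that
  \<open>W\<^sub>n(i, j) = E (R\<^sub>n; S\<^sub>0 = i, S\<^sub>n = j)\<close> satisfies
  \<open>W\<^sub>n\<^sub>+\<^sub>1(i, \<cdot>) = W\<^sub>n(i, \<cdot>) P + Pr (S\<^sub>0 = i) (P\<^sup>n H)(i, \<cdot>)\<close>. The matrix with blocks \<open>A\<^sub>n\<close> and
  \<open>B\<^sub>n\<close> satisfies the same recursion without the factor \<open>Pr (S\<^sub>0 = i)\<close>, and both vanish at
  \<open>n = 0\<close>. That \<open>I - Q\<close> is invertible is the maximum principle: a vector fixed by \<open>Q\<close>, extended by
  \<open>0\<close> to the absorbing states, attains its maximal modulus at every state reachable from a
  maximiser, hence at an absorbing state.
\<close>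

section \<open>Matrix sums and the block recursion\<close>

lemma mat_sum_carrier [simp]: "mat_sum nr nc F K \<in> carrier_mat nr nc"
  by (simp add: mat_sum_def)

lemma mat_sum_empty [simp]: "mat_sum nr nc F {} = 0\<^sub>m nr nc"
  by (rule eq_matI) (auto simp: mat_sum_def)

lemma mat_sum_Suc:
  assumes "F n \<in> carrier_mat nr nc"
  shows "mat_sum nr nc F {0..<Suc n} = mat_sum nr nc F {0..<n} + F n"
  using assms by (intro eq_matI) (auto simp: mat_sum_def)

lemma mat_sum_cong:
  assumes "\<And>k. k \<in> K \<Longrightarrow> F k = G k"
  shows "mat_sum nr nc F K = mat_sum nr nc G K"
  using assms by (auto simp: mat_sum_def intro!: cong_mat sum.cong)

lemma mat_sum_mult_right:
  assumes "\<And>k. k \<in> K \<Longrightarrow> F k \<in> carrier_mat nr n" and C: "C \<in> carrier_mat n nc"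
  shows "mat_sum nr n F K * C = mat_sum nr nc (\<lambda>k. F k * C) K"
proof (rule eq_matI)
  fix i j assume "i < dim_row (mat_sum nr nc (\<lambda>k. F k * C) K)"
    "j < dim_col (mat_sum nr nc (\<lambda>k. F k * C) K)"
  then have i: "i < nr" and j: "j < nc" by (auto simp: mat_sum_def)
  have entry: "(F k * C) $$ (i, j) = (\<Sum>l<n. F k $$ (i, l) * C $$ (l, j))" if "k \<in> K" for k
    using assms(1)[OF that] C i j by (simp add: scalar_prod_def lessThan_atLeast0)
  have "(mat_sum nr n F K * C) $$ (i, j) = (\<Sum>l<n. (\<Sum>k\<in>K. F k $$ (i, l)) * C $$ (l, j))"
    using C i j by (simp add: mat_sum_def scalar_prod_def lessThan_atLeast0)
  also have "\<dots> = (\<Sum>k\<in>K. \<Sum>l<n. F k $$ (i, l) * C $$ (l, j))"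
    by (simp add: sum_distrib_right sum.swap[of _ K])
  also have "\<dots> = mat_sum nr nc (\<lambda>k. F k * C) K $$ (i, j)"
    using i j by (simp add: mat_sum_def entry)
  finally show "(mat_sum nr n F K * C) $$ (i, j) = mat_sum nr nc (\<lambda>k. F k * C) K $$ (i, j)" .
qed (use C in \<open>auto simp: mat_sum_def\<close>)

lemma pow_mat_commute:
  assumes A: "A \<in> carrier_mat n n" and B: "B \<in> carrier_mat n n" and "A * B = B * A"
  shows "A ^\<^sub>m k * B = B * A ^\<^sub>m k"
proof (induction k)
  case 0
  then show ?case using A B by simp
next
  case (Suc k)
  have "A ^\<^sub>m Suc k * B = A ^\<^sub>m k * (B * A)"
    using A B assms(3) by (simp add: assoc_mult_mat[of _ n n _ n _ n])
  also have "\<dots> = A ^\<^sub>m k * B * A"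
    using A B by (simp add: assoc_mult_mat[of _ n n _ n _ n])
  also have "\<dots> = B * A ^\<^sub>m Suc k"
    using A B Suc.IH by (simp add: assoc_mult_mat[of _ n n _ n _ n])
  finally show ?case .
qed

text \<open>The block A_n. Summand \<open>i\<close> carries the reward of transition
  \<open>i + 1\<close>: \<open>i\<close> unrewarded transitions precede it and
  \<open>n - i - 1\<close> follow. The value at \<open>n = 0\<close> is the zero matrix, where the
  recursion starts.\<close>

definition reward_power_sum :: "real mat \<Rightarrow> real mat \<Rightarrow> nat \<Rightarrow> real mat" where
  "reward_power_sum Q H n =
     mat_sum (dim_row Q) (dim_row Q) (\<lambda>i. Q ^\<^sub>m i * H * Q ^\<^sub>m (n - i - 1)) {0..<n}"

lemma reward_power_sum_carrier [simp]:
  "Q \<in> carrier_mat t t \<Longrightarrow> reward_power_sum Q H n \<in> carrier_mat t t"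
  by (auto simp: reward_power_sum_def)

text \<open>One more transition appends a factor \<open>Q\<close> on the right of every old summand;
  the new summand \<open>i = n\<close> ends with the rewarded transition, its trailing power being
  \<open>Q^0\<close>.\<close>

lemma reward_power_sum_Suc:
  assumes Q: "Q \<in> carrier_mat t t" and H: "H \<in> carrier_mat t t"
  shows "reward_power_sum Q H (Suc n) = reward_power_sum Q H n * Q + Q ^\<^sub>m n * H"
proof -
  have "mat_sum t t (\<lambda>i. Q ^\<^sub>m i * H * Q ^\<^sub>m (Suc n - i - 1)) {0..<n}
      = mat_sum t t (\<lambda>i. (Q ^\<^sub>m i * H * Q ^\<^sub>m (n - i - 1)) * Q) {0..<n}"
  proof (rule mat_sum_cong)
    fix i assume "i \<in> {0..<n}"
    \<comment> \<open>Subtraction is truncated, so this uses \<open>i < n\<close>.\<close>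
    then have "Suc n - i - 1 = Suc (n - i - 1)" by auto
    then show "Q ^\<^sub>m i * H * Q ^\<^sub>m (Suc n - i - 1) = Q ^\<^sub>m i * H * Q ^\<^sub>m (n - i - 1) * Q"
      using Q H
      by (simp add: assoc_mult_mat[of _ t t _ t _ t] mult_carrier_mat[of _ t t])
  qed
  moreover have "Q ^\<^sub>m i * H * Q ^\<^sub>m (n - i - 1) \<in> carrier_mat t t" for i
    using Q H by (simp add: mult_carrier_mat[of _ t t])
  moreover have "Q ^\<^sub>m n * H * Q ^\<^sub>m (Suc n - n - 1) = Q ^\<^sub>m n * H"
    using Q H by (simp add: right_mult_one_mat[of _ t] mult_carrier_mat[of _ t t])
  moreover have "Q ^\<^sub>m n * H \<in> carrier_mat t t"
    using Q H by (simp add: mult_carrier_mat[of _ t t])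
  ultimately show ?thesis
    using Q mat_sum_mult_right[of "{0..<n}" "\<lambda>i. Q ^\<^sub>m i * H * Q ^\<^sub>m (n - i - 1)" t t Q t]
      mat_sum_Suc[of "\<lambda>i. Q ^\<^sub>m i * H * Q ^\<^sub>m (Suc n - i - 1)" n t t]
    by (simp only: reward_power_sum_def carrier_matD)
qed

text \<open>
  The absorbing block regrouped by means of \<open>Q\<^sup>k N = N Q\<^sup>k\<close>; in this form its increments are
  visible.
\<close>

definition absorbing_reward ::
    "real mat \<Rightarrow> real mat \<Rightarrow> real mat \<Rightarrow> real mat \<Rightarrow> real mat \<Rightarrow> nat \<Rightarrow> real mat" where
  "absorbing_reward Q R H\<^sub>1 H\<^sub>2 N n =
     N * (1\<^sub>m (dim_row Q) - Q ^\<^sub>m n) * (H\<^sub>2 + H\<^sub>1 * (N * R)) - reward_power_sum Q H\<^sub>1 n * (N * R)"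

definition reward_block ::
    "real mat \<Rightarrow> real mat \<Rightarrow> real mat \<Rightarrow> real mat \<Rightarrow> real mat \<Rightarrow> nat \<Rightarrow> real mat" where
  "reward_block Q R H\<^sub>1 H\<^sub>2 N n = four_block_mat (reward_power_sum Q H\<^sub>1 n)
     (absorbing_reward Q R H\<^sub>1 H\<^sub>2 N n) (0\<^sub>m (dim_col R) (dim_row Q)) (0\<^sub>m (dim_col R) (dim_col R))"

section \<open>Recursion and closed form of the blocks, given a two-sided inverse of I - Q\<close>

context
  fixes t a :: nat and Q R H\<^sub>1 H\<^sub>2 N :: "real mat"
  assumes Q: "Q \<in> carrier_mat t t" and R: "R \<in> carrier_mat t a"
    and H1: "H\<^sub>1 \<in> carrier_mat t t" and H2: "H\<^sub>2 \<in> carrier_mat t a"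
    and N: "N \<in> carrier_mat t t"
    and left_inverse: "N * (1\<^sub>m t - Q) = 1\<^sub>m t" and right_inverse: "(1\<^sub>m t - Q) * N = 1\<^sub>m t"
begin

private lemma pow_carrier: "Q ^\<^sub>m k \<in> carrier_mat t t"
  using Q by simp

text \<open>Expanding the two inverse laws gives N - NQ = I = N - QN, so \<open>N\<close> commutes
  with \<open>Q\<close> and hence with its powers.\<close>

private lemma fundamental_commute: "Q ^\<^sub>m k * N = N * Q ^\<^sub>m k"
proof -
  have "N - N * Q = 1\<^sub>m t" "N - Q * N = 1\<^sub>m t"
    using Q N left_inverse right_inverse
    by (simp_all add: mult_minus_distrib_mat[of _ t t _ t] minus_mult_distrib_mat[of _ t t _ _ t])
  then have "N - N * Q = N - Q * N" by simp
  \<comment> \<open>\<open>N\<close> is cancelled entry by entry; the entry rule for products is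
    switched off so that both products stay atomic.\<close>
  have "Q * N = N * Q"
  proof (rule eq_matI)
    fix i j assume "i < dim_row (N * Q)" "j < dim_col (N * Q)"
    then show "(Q * N) $$ (i, j) = (N * Q) $$ (i, j)"
      using arg_cong[OF \<open>N - N * Q = N - Q * N\<close>, of "\<lambda>A. A $$ (i, j)"] Q N
      by (simp del: index_mult_mat(1))
  qed (use Q N in auto)
  then show ?thesis
    using Q N by (rule pow_mat_commute[rotated 2])
qed

text \<open>N(I - Q^k) is the geometric sum I + Q + ... + Q^(k-1). The increment comes from Q^k =
  Q^k N (I - Q) = N(Q^k - Q^(k+1)), after moving \<open>N\<close> past Q^k.\<close>

private lemma geometric_Suc:
  "N * (1\<^sub>m t - Q ^\<^sub>m Suc k) = N * (1\<^sub>m t - Q ^\<^sub>m k) + Q ^\<^sub>m k"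
proof -
  have Qk: "Q ^\<^sub>m k \<in> carrier_mat t t" by (rule pow_carrier)
  then have QkQ: "Q ^\<^sub>m k * Q \<in> carrier_mat t t" using Q by (rule mult_carrier_mat)
  have "Q ^\<^sub>m k * (N * (1\<^sub>m t - Q)) = Q ^\<^sub>m k"
    using Q by (simp add: left_inverse right_mult_one_mat[of _ t])
  then have "Q ^\<^sub>m k = (Q ^\<^sub>m k * N) * (1\<^sub>m t - Q)"
    using Qk Q N by (simp add: assoc_mult_mat[of _ t t _ t _ t] minus_carrier_mat)
  also have "\<dots> = N * (Q ^\<^sub>m k - Q ^\<^sub>m k * Q)"
    using mult_minus_distrib_mat[OF Qk one_carrier_mat Q]
      assoc_mult_mat[OF N Qk minus_carrier_mat[OF Q]] Qk
    by (simp add: fundamental_commute right_mult_one_mat[of _ t t] del: assoc_mult_mat)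
  finally have "N * (1\<^sub>m t - Q ^\<^sub>m k) + Q ^\<^sub>m k
      = N * ((1\<^sub>m t - Q ^\<^sub>m k) + (Q ^\<^sub>m k - Q ^\<^sub>m k * Q))"
    using N Qk QkQ by (simp add: mult_add_distrib_mat[of N t t _ t] minus_carrier_mat)
  also have "(1\<^sub>m t - Q ^\<^sub>m k) + (Q ^\<^sub>m k - Q ^\<^sub>m k * Q) = 1\<^sub>m t - Q ^\<^sub>m Suc k"
  proof -
    have "(X - Y) + (Y - Z) = X - Z"
      if "X \<in> carrier_mat t t" "Y \<in> carrier_mat t t" "Z \<in> carrier_mat t t" for X Y Z :: "real mat"
      using that by (intro eq_matI) auto
    then show ?thesis using Qk QkQ by simp
  qed
  finally show ?thesis by simp
qed

lemma absorbing_reward_carrier: "absorbing_reward Q R H\<^sub>1 H\<^sub>2 N n \<in> carrier_mat t a"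
  using Q R by (auto simp: absorbing_reward_def reward_power_sum_def mat_sum_def)

text \<open>With \<open>G\<close>, \<open>A\<close> and \<open>E\<close> as in the proof, passing to
  \<open>Suc n\<close> adds Q^n to \<open>G\<close> and turns \<open>A\<close> into AQ + Q^n
  \<open>H\<^sub>1\<close>. The two terms Q^n E cancel, and ANR - AQNR = AR because R = (I -
  Q)NR.\<close>

lemma absorbing_reward_Suc:
  "absorbing_reward Q R H\<^sub>1 H\<^sub>2 N (Suc n)
     = reward_power_sum Q H\<^sub>1 n * R + absorbing_reward Q R H\<^sub>1 H\<^sub>2 N n + Q ^\<^sub>m n * H\<^sub>2"
proof -
  define A G E where "A = reward_power_sum Q H\<^sub>1 n" and "G = N * (1\<^sub>m t - Q ^\<^sub>m n)"
    and "E = H\<^sub>1 * (N * R)"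
  have c: "A \<in> carrier_mat t t" "G \<in> carrier_mat t t" "E \<in> carrier_mat t a"
    "Q ^\<^sub>m n \<in> carrier_mat t t" "N * R \<in> carrier_mat t a"
    using Q N H1 R by (auto simp: A_def G_def E_def)
  have "R = (1\<^sub>m t - Q) * N * R" using R by (simp add: right_inverse)
  also have "\<dots> = N * R - Q * (N * R)"
    using Q N R c by (simp add: assoc_mult_mat[of _ t t _ t _ a] minus_carrier_mat
        minus_mult_distrib_mat[of _ t t])
  finally have "A * R = A * (N * R - Q * (N * R))" by (rule arg_cong)
  then have AR: "A * R = A * (N * R) - A * (Q * (N * R))"
    using mult_minus_distrib_mat[OF c(1,5) mult_carrier_mat[OF Q c(5)]] by simp
  have "absorbing_reward Q R H\<^sub>1 H\<^sub>2 N (Suc n)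
      = (G + Q ^\<^sub>m n) * (H\<^sub>2 + E) - (A * Q + Q ^\<^sub>m n * H\<^sub>1) * (N * R)"
    using Q geometric_Suc[of n] reward_power_sum_Suc[OF Q H1]
    by (simp add: absorbing_reward_def A_def G_def E_def)
  also have "(G + Q ^\<^sub>m n) * (H\<^sub>2 + E) = G * (H\<^sub>2 + E) + (Q ^\<^sub>m n * H\<^sub>2 + Q ^\<^sub>m n * E)"
    using add_mult_distrib_mat[OF c(2,4) add_carrier_mat[OF c(3)]]
      mult_add_distrib_mat[OF c(4) H2 c(3)] by simp
  also have "(A * Q + Q ^\<^sub>m n * H\<^sub>1) * (N * R) = A * (Q * (N * R)) + Q ^\<^sub>m n * E"
    using add_mult_distrib_mat[OF mult_carrier_mat[OF c(1) Q] mult_carrier_mat[OF c(4) H1] c(5)]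
      assoc_mult_mat[OF c(1) Q c(5)] assoc_mult_mat[OF c(4) H1 c(5)] by (simp add: E_def)
  also have "(G * (H\<^sub>2 + E) + (Q ^\<^sub>m n * H\<^sub>2 + Q ^\<^sub>m n * E))
      - (A * (Q * (N * R)) + Q ^\<^sub>m n * E)
      = (A * (N * R) - A * (Q * (N * R))) + (G * (H\<^sub>2 + E) - A * (N * R)) + Q ^\<^sub>m n * H\<^sub>2"
  proof -
    have "(X + (Y + Z)) - (V + Z) = (U - V) + (X - U) + Y"
      if "X \<in> carrier_mat t a" "Y \<in> carrier_mat t a" "Z \<in> carrier_mat t a"
        "U \<in> carrier_mat t a" "V \<in> carrier_mat t a" for X Y Z U V :: "real mat"
      using that by (intro eq_matI) auto
    then show ?thesis
      using mult_carrier_mat[OF c(2) add_carrier_mat[OF c(3)]] mult_carrier_mat[OF c(4) H2]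
        mult_carrier_mat[OF c(4,3)] mult_carrier_mat[OF c(1,5)]
        mult_carrier_mat[OF c(1) mult_carrier_mat[OF Q c(5)]] by blast
  qed
  also have "\<dots> = A * R + absorbing_reward Q R H\<^sub>1 H\<^sub>2 N n + Q ^\<^sub>m n * H\<^sub>2"
    using Q by (simp add: absorbing_reward_def flip: AR A_def G_def E_def)
  finally show ?thesis by (simp add: A_def)
qed

text \<open>Return to the ungrouped form. The last summand of A_n N R has no trailing
  \<open>Q\<close> and equals Q^(n-1) \<open>H\<^sub>1\<close> N R. It cancels against the last term
  of the geometric sum in front of \<open>H\<^sub>1\<close> N R, which lowers that exponent from n
  to n - 1 and ends the remaining sum at n - 2. In the other summands \<open>N\<close> is moved to
  the left of the trailing power of \<open>Q\<close>.\<close>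

lemma absorbing_reward_eq:
  assumes "n \<ge> 1"
  shows "absorbing_reward Q R H\<^sub>1 H\<^sub>2 N n =
    N * (1\<^sub>m t - Q ^\<^sub>m n) * H\<^sub>2 + N * (1\<^sub>m t - Q ^\<^sub>m (n - 1)) * H\<^sub>1 * N * R
      - mat_sum t a (\<lambda>i. Q ^\<^sub>m i * H\<^sub>1 * N * Q ^\<^sub>m (n - i - 1) * R) {0..<n - 1}"
proof -
  obtain m where n_eq: "n = Suc m" using assms by (cases n) auto
  define G G' E where "G = N * (1\<^sub>m t - Q ^\<^sub>m n)" and "G' = N * (1\<^sub>m t - Q ^\<^sub>m m)"
    and "E = H\<^sub>1 * (N * R)"
  let ?F = "\<lambda>i. Q ^\<^sub>m i * H\<^sub>1 * Q ^\<^sub>m (n - i - 1)"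
  let ?D = "mat_sum t a (\<lambda>i. Q ^\<^sub>m i * H\<^sub>1 * N * Q ^\<^sub>m (n - i - 1) * R) {0..<m}"
  have c: "G \<in> carrier_mat t t" "G' \<in> carrier_mat t t" "E \<in> carrier_mat t a"
    "N * R \<in> carrier_mat t a" "?D \<in> carrier_mat t a"
    using Q N H1 R by (auto simp: G_def G'_def E_def)
  have G_eq: "G = G' + Q ^\<^sub>m m"
    using geometric_Suc[of m] by (simp only: n_eq G_def G'_def)
  have Fc: "?F i \<in> carrier_mat t t" for i
    using Q H1 by (simp add: mult_carrier_mat[of _ t t])
  have F: "?F i * (N * R) = Q ^\<^sub>m i * H\<^sub>1 * N * Q ^\<^sub>m (n - i - 1) * R" for i
  proof -
    have "?F i * (N * R) = Q ^\<^sub>m i * H\<^sub>1 * (Q ^\<^sub>m (n - i - 1) * N) * R"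
      using pow_carrier[of i] pow_carrier[of "n - i - 1"] H1 N R
      by (simp add: assoc_mult_mat[of _ t t _ t _ t] assoc_mult_mat[of _ t t _ t _ a])
    then show ?thesis
      using pow_carrier[of i] pow_carrier[of "n - i - 1"] H1 N
      by (simp add: fundamental_commute assoc_mult_mat[of _ t t _ t _ t])
  qed
  have "reward_power_sum Q H\<^sub>1 n * (N * R)
      = mat_sum t a (\<lambda>i. ?F i * (N * R)) {0..<Suc m}"
    using Q c(4) Fc mat_sum_mult_right[of "{0..<n}" ?F t t "N * R" a]
    by (simp add: reward_power_sum_def n_eq)
  also have "\<dots> = mat_sum t a (\<lambda>i. ?F i * (N * R)) {0..<m} + ?F m * (N * R)"
    by (rule mat_sum_Suc) (rule mult_carrier_mat[OF Fc c(4)])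
  also have "mat_sum t a (\<lambda>i. ?F i * (N * R)) {0..<m} = ?D"
    by (rule mat_sum_cong) (rule F)
  also have "?F m * (N * R) = Q ^\<^sub>m m * E"
    using pow_carrier[of m] Q H1 c(4)
    by (simp add: n_eq E_def assoc_mult_mat[of _ t t _ t _ a])
  finally have "reward_power_sum Q H\<^sub>1 n * (N * R) = ?D + Q ^\<^sub>m m * E" .
  then have "absorbing_reward Q R H\<^sub>1 H\<^sub>2 N n
      = G * H\<^sub>2 + (G' * E + Q ^\<^sub>m m * E) - (?D + Q ^\<^sub>m m * E)"
    using Q c H2 pow_carrier[of m] G_eq
    by (simp add: absorbing_reward_def mult_add_distrib_mat[of _ t t _ a]
        add_mult_distrib_mat[of _ t t _ _ a] flip: G_def E_def)
  also have "\<dots> = G * H\<^sub>2 + G' * E - ?D"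
  proof -
    have "X + (Y + Z) - (D + Z) = X + Y - D"
      if "X \<in> carrier_mat t a" "Y \<in> carrier_mat t a" "Z \<in> carrier_mat t a" "D \<in> carrier_mat t a"
      for X Y Z D :: "real mat"
      using that by (intro eq_matI) auto
    then show ?thesis
      using mult_carrier_mat[OF c(1) H2] mult_carrier_mat[OF c(2,3)]
        mult_carrier_mat[OF pow_carrier c(3)] c(5) by blast
  qed
  also have "G' * E = G' * H\<^sub>1 * N * R"
    using c H1 N R
    by (simp add: E_def assoc_mult_mat[of _ t t _ t _ a] assoc_mult_mat[of _ t t _ t _ t])
  finally show ?thesis by (simp add: G_def G'_def n_eq)
qed

lemma reward_block_0: "reward_block Q R H\<^sub>1 H\<^sub>2 N 0 = 0\<^sub>m (t + a) (t + a)"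
proof -
  have "absorbing_reward Q R H\<^sub>1 H\<^sub>2 N 0 = 0\<^sub>m t a"
    using Q R H1 H2 N
    by (simp add: absorbing_reward_def reward_power_sum_def minus_r_inv_mat[of _ t t])
  then show ?thesis
    using Q R by (simp add: reward_block_def reward_power_sum_def)
qed

text \<open>The upper right block is left unspecified, since in the recursion it only multiplies the
  zero rows of the reward matrix.\<close>

lemma pow_four_block_absorbing:
  "\<exists>X \<in> carrier_mat t a. (four_block_mat Q R (0\<^sub>m a t) (1\<^sub>m a)) ^\<^sub>m n
     = four_block_mat (Q ^\<^sub>m n) X (0\<^sub>m a t) (1\<^sub>m a)"
proof (induction n)
  case 0
  then show ?case using Q by (intro bexI[of _ "0\<^sub>m t a"]) simp_all
next
  case (Suc n)
  then obtain X where X: "X \<in> carrier_mat t a"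
    and eq: "(four_block_mat Q R (0\<^sub>m a t) (1\<^sub>m a)) ^\<^sub>m n
     = four_block_mat (Q ^\<^sub>m n) X (0\<^sub>m a t) (1\<^sub>m a)" by blast
  show ?case
    using X Q R pow_carrier[of n] mult_carrier_mat[OF pow_carrier[of n] Q]
    by (intro bexI[of _ "Q ^\<^sub>m n * R + X"])
      (simp_all add: eq mult_four_block_mat[of _ t t _ a _ a _ _ t _ a])
qed

text \<open>Block multiplication: the identity block of the transition matrix carries the absorbing
  rewards over unchanged, \<open>R\<close> moves transient rewards into the absorbing block, and the
  second product contributes Q^n \<open>H\<^sub>1\<close> and Q^n \<open>H\<^sub>2\<close>.\<close>

lemma reward_block_Suc:
  "reward_block Q R H\<^sub>1 H\<^sub>2 N (Suc n)
     = reward_block Q R H\<^sub>1 H\<^sub>2 N n * four_block_mat Q R (0\<^sub>m a t) (1\<^sub>m a)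
     + (four_block_mat Q R (0\<^sub>m a t) (1\<^sub>m a)) ^\<^sub>m n
       * four_block_mat H\<^sub>1 H\<^sub>2 (0\<^sub>m a t) (0\<^sub>m a a)"
proof -
  obtain X where X: "X \<in> carrier_mat t a"
    and eq: "(four_block_mat Q R (0\<^sub>m a t) (1\<^sub>m a)) ^\<^sub>m n
     = four_block_mat (Q ^\<^sub>m n) X (0\<^sub>m a t) (1\<^sub>m a)"
    using pow_four_block_absorbing by blast
  note c = Q R H1 H2 X pow_carrier[of n] absorbing_reward_carrier[of n]
  have "reward_block Q R H\<^sub>1 H\<^sub>2 N n * four_block_mat Q R (0\<^sub>m a t) (1\<^sub>m a)
      = four_block_mat (reward_power_sum Q H\<^sub>1 n * Q)
          (reward_power_sum Q H\<^sub>1 n * R + absorbing_reward Q R H\<^sub>1 H\<^sub>2 N n) (0\<^sub>m a t) (0\<^sub>m a a)"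
    using c by (simp add: reward_block_def mult_four_block_mat[of _ t t _ a _ a _ _ t _ a]
        mult_carrier_mat[of _ t t] right_add_zero_mat[of _ t t])
  moreover have "(four_block_mat Q R (0\<^sub>m a t) (1\<^sub>m a)) ^\<^sub>m n
        * four_block_mat H\<^sub>1 H\<^sub>2 (0\<^sub>m a t) (0\<^sub>m a a)
      = four_block_mat (Q ^\<^sub>m n * H\<^sub>1) (Q ^\<^sub>m n * H\<^sub>2) (0\<^sub>m a t) (0\<^sub>m a a)"
    unfolding eq using c by (simp add: mult_four_block_mat[of _ t t _ a _ a _ _ t _ a]
        mult_carrier_mat[of _ t t] right_add_zero_mat[of _ t])
  ultimately show ?thesis
    using c by (simp add: reward_block_def absorbing_reward_Suc reward_power_sum_Suc
        add_four_block_mat[of _ t t _ a _ a] mult_carrier_mat[of _ t t] del: pow_mat.simps)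
qed

end

section \<open>Invertibility of the transient block\<close>

lemma max_principle_absorbing:
  fixes w :: "nat \<Rightarrow> real"
  assumes chain: "absorbing_chain P"
    and harmonic: "\<And>i. i \<in> transient_states P \<Longrightarrow> w i = (\<Sum>j<dim_row P. P $$ (i, j) * w j)"
    and boundary: "\<And>i. i \<in> absorbing_states P \<Longrightarrow> w i = 0"
    and i: "i < dim_row P"
  shows "w i = 0"
proof (rule ccontr)
  assume "w i \<noteq> 0"
  define d where "d = dim_row P"
  define m where "m = Max ((\<lambda>i. \<bar>w i\<bar>) ` {..<d})"
  have le: "\<bar>w j\<bar> \<le> m" if "j < d" for j
    using that by (auto simp: m_def)
  have "m \<in> (\<lambda>i. \<bar>w i\<bar>) ` {..<d}"
    unfolding m_def using i by (intro Max_in) (auto simp: d_def)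
  then obtain k where k: "k < d" "\<bar>w k\<bar> = m" by auto
  have "m > 0" using le[of i] i \<open>w i \<noteq> 0\<close> by (simp add: d_def)
  have nonneg: "0 \<le> P $$ (i, j)" and stoch: "(\<Sum>j<d. P $$ (i, j)) = 1"
    if "i < d" "j < d" for i j
    using chain that by (auto simp: absorbing_chain_def transition_matrix_def d_def)
  \<comment> \<open>Maximal modulus propagates along transitions: \<open>i\<close> cannot be
    absorbing because m > 0, so w(i) is a weighted average of values of modulus at most m. A smaller
    modulus at \<open>j\<close>, which has positive weight, would make the average strictly
    smaller.\<close>
  have step: "\<bar>w j\<bar> = m" if "(i, j) \<in> transitions P" "\<bar>w i\<bar> = m" for i j
  proof (rule ccontr)
    assume ne: "\<bar>w j\<bar> \<noteq> m"
    have ij: "i < d" "j < d" "0 < P $$ (i, j)"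
      using that(1) by (auto simp: transitions_def d_def)
    have "i \<notin> absorbing_states P" using boundary[of i] that(2) \<open>m > 0\<close> by auto
    then have "i \<in> transient_states P" using ij by (auto simp: transient_states_def d_def)
    then have "m = \<bar>\<Sum>l<d. P $$ (i, l) * w l\<bar>"
      using harmonic[of i] that(2) by (simp add: d_def)
    also have "\<dots> \<le> (\<Sum>l<d. \<bar>P $$ (i, l) * w l\<bar>)" by (rule sum_abs)
    also have "\<dots> < (\<Sum>l<d. P $$ (i, l) * m)"
    proof (rule sum_strict_mono_ex1)
      show "\<forall>l\<in>{..<d}. \<bar>P $$ (i, l) * w l\<bar> \<le> P $$ (i, l) * m"
        using nonneg ij le by (auto simp: abs_mult intro!: mult_left_mono)
      show "\<exists>l\<in>{..<d}. \<bar>P $$ (i, l) * w l\<bar> < P $$ (i, l) * m"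
        using ij le[of j] ne by (intro bexI[of _ j]) (auto simp: abs_mult)
    qed simp
    also have "\<dots> = m" using stoch[OF ij(1,2)] by (simp flip: sum_distrib_right)
    finally show False by simp
  qed
  have reach: "\<bar>w j\<bar> = m" if "(k, j) \<in> (transitions P)\<^sup>*" for j
    using that by (induction rule: rtrancl_induct) (auto simp: k step)
  \<comment> \<open>If \<open>k\<close> is itself absorbing, the empty path serves.\<close>
  have "\<exists>j\<in>absorbing_states P. (k, j) \<in> (transitions P)\<^sup>*"
    using chain k by (cases "k \<in> absorbing_states P")
      (auto simp: absorbing_chain_def transient_states_def d_def)
  then show False using reach boundary \<open>m > 0\<close> by fastforce
qed

text \<open>\<open>fundamental_matrix\<close> unwraps an option, so existence of the inverse has to
  come first. It follows from a nonzero determinant, that is, from a trivial kernel of I -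
  Q.\<close>

lemma fundamental_matrix_inverse:
  assumes Q: "Q \<in> carrier_mat t t" and R: "R \<in> carrier_mat t a"
    and P: "P = four_block_mat Q R (0\<^sub>m a t) (1\<^sub>m a)"
    and absorbing: "absorbing_chain P"
    and canonical: "transient_states P = {0..<t}" "absorbing_states P = {t..<t + a}"
  shows "fundamental_matrix Q \<in> carrier_mat t t"
    "fundamental_matrix Q * (1\<^sub>m t - Q) = 1\<^sub>m t"
    "(1\<^sub>m t - Q) * fundamental_matrix Q = 1\<^sub>m t"
proof -
  have IQ: "1\<^sub>m t - Q \<in> carrier_mat t t" using Q by (simp add: minus_carrier_mat)
  have "det (1\<^sub>m t - Q) \<noteq> 0"
  proof
    assume "det (1\<^sub>m t - Q) = 0"
    then obtain v where v: "v \<in> carrier_vec t" "v \<noteq> 0\<^sub>v t" "(1\<^sub>m t - Q) *\<^sub>v v = 0\<^sub>v t"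
      using det_0_iff_vec_prod_zero_field[OF IQ] by auto
    \<comment> \<open>Extending a kernel vector by 0 to the absorbing states turns Qv = v into
      harmonicity for the full matrix \<open>P\<close>.\<close>
    define w where "w i = (if i < t then v $ i else 0)" for i
    have dim: "dim_row P = t + a" using Q by (simp add: P)
    have "w i = (\<Sum>j<t + a. P $$ (i, j) * w j)" if "i < t" for i
    proof -
      have "v - Q *\<^sub>v v = 0\<^sub>v t"
        using v Q by (simp add: minus_mult_distrib_mat_vec[of _ t t])
      then have "v $ i - (Q *\<^sub>v v) $ i = 0"
        using that v Q by (metis index_minus_vec(1) index_zero_vec(1) carrier_matD(1) dim_mult_mat_vec)
      then have "v $ i = (\<Sum>j<t. Q $$ (i, j) * v $ j)"
        using that v Q by (simp add: scalar_prod_def lessThan_atLeast0)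
      also have "\<dots> = (\<Sum>j<t. P $$ (i, j) * w j)"
        using that Q R by (intro sum.cong) (auto simp: P w_def)
      also have "\<dots> = (\<Sum>j<t + a. P $$ (i, j) * w j)"
        by (rule sum.mono_neutral_left) (auto simp: w_def)
      finally show ?thesis using that by (simp add: w_def)
    qed
    then have harmonic: "\<And>i. i \<in> transient_states P \<Longrightarrow> w i = (\<Sum>j<dim_row P. P $$ (i, j) * w j)"
      by (simp add: canonical dim)
    have "v $ i = 0" if "i < t" for i
      using that max_principle_absorbing[where w = w, OF absorbing harmonic, of i]
      by (simp add: canonical dim w_def)
    then have "v = 0\<^sub>v t" using v(1) by (intro eq_vecI) auto
    with v(2) show False by simp
  qed
  \<comment> \<open>Being a unit of the matrix ring excludes the result \<open>None\<close>.\<close>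
  then have "1\<^sub>m t - Q \<in> Units (ring_mat TYPE(real) t ())"
    by (rule det_non_zero_imp_unit[OF IQ])
  then obtain B where "mat_inverse (1\<^sub>m t - Q) = Some B"
    using mat_inverse(1)[OF IQ, of "()"] by (cases "mat_inverse (1\<^sub>m t - Q)") auto
  then show "fundamental_matrix Q \<in> carrier_mat t t"
    "fundamental_matrix Q * (1\<^sub>m t - Q) = 1\<^sub>m t"
    "(1\<^sub>m t - Q) * fundamental_matrix Q = 1\<^sub>m t"
    using mat_inverse(2)[OF IQ] Q by (auto simp: fundamental_matrix_def)
qed

section \<open>Expected rewards between fixed endpoints\<close>

text \<open>Reduces a conditional expectation to an expectation restricted to the event. The
  conditional law has density \<open>indicator A / emeasure M A\<close>, which is real-valued
  because the event has finite nonzero measure.\<close>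

lemma integral_uniform_measure:
  fixes f :: "'a \<Rightarrow> real"
  assumes f: "f \<in> borel_measurable M" and A: "A \<in> sets M"
    and pos: "emeasure M A \<noteq> 0" "emeasure M A \<noteq> \<infinity>"
  shows "(\<integral>x. f x \<partial>uniform_measure M A) = (\<integral>x. f x * indicator A x \<partial>M) / measure M A"
proof -
  have "measure M A > 0"
    using pos by (simp add: measure_def enn2real_positive_iff less_top zero_less_iff_neq_zero)
  then have density: "indicator A x / emeasure M A = ennreal (indicator A x / measure M A)" for x
    using pos by (simp add: emeasure_eq_ennreal_measure divide_ennreal flip: ennreal_indicator)
  have "(\<integral>x. f x \<partial>uniform_measure M A) = (\<integral>x. (indicator A x / measure M A) *\<^sub>R f x \<partial>M)"
    unfolding uniform_measure_def density using f A by (intro integral_density) auto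
  also have "\<dots> = (\<integral>x. f x * indicator A x / measure M A \<partial>M)"
    by (simp add: mult.commute)
  finally show ?thesis by simp
qed

text \<open>On the space, f(X) is a finite linear combination of indicators of the events X = x, so
  integrability and the formula hold for arbitrary \<open>f\<close>.\<close>

lemma (in prob_space) finite_range_expectation:
  fixes f :: "'b \<Rightarrow> real"
  assumes X: "X \<in> measurable M (count_space C)" and C: "finite C"
  shows integrable_finite_range: "integrable M (\<lambda>\<omega>. f (X \<omega>))"
    and expectation_finite_range: "expectation (\<lambda>\<omega>. f (X \<omega>)) = (\<Sum>x\<in>C. f x * prob {\<omega> \<in> space M. X \<omega> = x})"
proof -
  have sets: "{\<omega> \<in> space M. X \<omega> = x} \<in> events" if "x \<in> C" for x
  proof -
    have "X -` {x} \<inter> space M \<in> events"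
      using X by (rule measurable_sets) (use that in simp)
    moreover have "X -` {x} \<inter> space M = {\<omega> \<in> space M. X \<omega> = x}" by auto
    ultimately show ?thesis by simp
  qed
  have eq: "f (X \<omega>) = (\<Sum>x\<in>C. f x * indicator {\<omega> \<in> space M. X \<omega> = x} \<omega>)"
    if \<omega>: "\<omega> \<in> space M" for \<omega>
  proof -
    have "X \<omega> \<in> C" using measurable_space[OF X \<omega>] by simp
    then have "f (X \<omega>) = (\<Sum>x\<in>C. if x = X \<omega> then f x else 0)"
      using C by (simp add: sum.delta')
    also have "\<dots> = (\<Sum>x\<in>C. f x * indicator {\<omega> \<in> space M. X \<omega> = x} \<omega>)"
      using \<omega> by (intro sum.cong) (auto simp: indicator_def)
    finally show ?thesis .
  qed
  have int: "integrable M (\<lambda>\<omega>. f x * indicator {\<omega> \<in> space M. X \<omega> = x} \<omega>)" if "x \<in> C" for x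
    using sets[OF that] by (intro integrable_mult_right) (auto simp: less_top[symmetric])
  have "integrable M (\<lambda>\<omega>. \<Sum>x\<in>C. f x * indicator {\<omega> \<in> space M. X \<omega> = x} \<omega>)"
    using int by (rule Bochner_Integration.integrable_sum)
  then show "integrable M (\<lambda>\<omega>. f (X \<omega>))"
    by (subst Bochner_Integration.integrable_cong[OF refl eq])
  have "expectation (\<lambda>\<omega>. f (X \<omega>)) = expectation (\<lambda>\<omega>. \<Sum>x\<in>C. f x * indicator {\<omega> \<in> space M. X \<omega> = x} \<omega>)"
    by (rule Bochner_Integration.integral_cong) (simp_all add: eq)
  also have "\<dots> = (\<Sum>x\<in>C. expectation (\<lambda>\<omega>. f x * indicator {\<omega> \<in> space M. X \<omega> = x} \<omega>))"
    using int by (rule Bochner_Integration.integral_sum)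
  also have "\<dots> = (\<Sum>x\<in>C. f x * prob {\<omega> \<in> space M. X \<omega> = x})"
    using sets by (intro sum.cong) auto
  finally show "expectation (\<lambda>\<omega>. f (X \<omega>)) = (\<Sum>x\<in>C. f x * prob {\<omega> \<in> space M. X \<omega> = x})" .
qed

section \<open>Histories and one-step conditioning under a single law\<close>

locale discrete_markov_chain =
  fixes M :: "'w measure" and S :: "nat \<Rightarrow> 'w \<Rightarrow> nat" and P :: "real mat" and d :: nat
  assumes markov: "markov_chain M S P" and dim: "P \<in> carrier_mat d d"
begin

sublocale prob_space M
  using markov by (simp add: markov_chain_def)

lemma state_measurable [measurable]: "S n \<in> measurable M (count_space {0..<d})"
  using markov dim by (auto simp: markov_chain_def)

lemma state_less: "\<omega> \<in> space M \<Longrightarrow> S n \<omega> < d"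
  using measurable_space[OF state_measurable] by fastforce

text \<open>Restriction to times up to \<open>n\<close> makes the values extensional functions, so
  that histories range over the finite set \<open>paths n\<close>.\<close>

definition history :: "nat \<Rightarrow> 'w \<Rightarrow> nat \<Rightarrow> nat" where
  "history n \<omega> = (\<lambda>k\<in>{..n}. S k \<omega>)"

abbreviation paths :: "nat \<Rightarrow> (nat \<Rightarrow> nat) set" where
  "paths n \<equiv> {..n} \<rightarrow>\<^sub>E {0..<d}"

lemma finite_paths: "finite (paths n)"
  by (intro finite_PiE) auto

lemma event_all_le: "{\<omega> \<in> space M. \<forall>k\<le>n. S k \<omega> = x k} \<in> events"
proof -
  have "{\<omega> \<in> space M. S k \<omega> = x k} \<in> events" for k
  proof -
    have "S k -` ({x k} \<inter> {0..<d}) \<inter> space M \<in> events"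
      by (rule measurable_sets[OF state_measurable]) auto
    moreover have "S k -` ({x k} \<inter> {0..<d}) \<inter> space M = {\<omega> \<in> space M. S k \<omega> = x k}"
      using state_less[of _ k] by (auto, metis)
    ultimately show ?thesis by simp
  qed
  then have "{\<omega> \<in> space M. \<forall>k\<in>{..n}. S k \<omega> = x k} \<in> events"
    by (intro sets.sets_Collect_finite_All) auto
  then show ?thesis by (simp add: Ball_def)
qed

lemma history_apply [simp]: "k \<le> n \<Longrightarrow> history n \<omega> k = S k \<omega>"
  by (simp add: history_def)

lemma history_eq_iff:
  "x \<in> paths n \<Longrightarrow> history n \<omega> = x \<longleftrightarrow> (\<forall>k\<le>n. S k \<omega> = x k)"
  by (auto simp: history_def fun_eq_iff PiE_def extensional_def restrict_def)

lemma history_measurable: "history n \<in> measurable M (count_space (paths n))"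
proof (subst measurable_count_space_eq2[OF finite_paths], intro conjI ballI)
  show "history n \<in> space M \<rightarrow> paths n"
    by (auto simp: history_def state_less)
  fix x assume x: "x \<in> paths n"
  have "history n -` {x} \<inter> space M = {\<omega> \<in> space M. \<forall>k\<le>n. S k \<omega> = x k}"
    by (auto simp: history_eq_iff[OF x])
  then show "history n -` {x} \<inter> space M \<in> events" by (simp add: event_all_le)
qed

text \<open>On a path of probability 0 the Markov clauses are silent, but both sides vanish by
  monotonicity. Otherwise the event S_n = x(n) contains the path event and has positive probability
  too, so both clauses apply.\<close>

lemma prob_path_Suc:
  assumes "x n < d" "j < d"
  shows "prob {\<omega> \<in> space M. (\<forall>k\<le>n. S k \<omega> = x k) \<and> S (Suc n) \<omega> = j}
    = prob {\<omega> \<in> space M. \<forall>k\<le>n. S k \<omega> = x k} * P $$ (x n, j)"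
proof (cases "prob {\<omega> \<in> space M. \<forall>k\<le>n. S k \<omega> = x k} = 0")
  case True
  have "prob {\<omega> \<in> space M. (\<forall>k\<le>n. S k \<omega> = x k) \<and> S (Suc n) \<omega> = j}
      \<le> prob {\<omega> \<in> space M. \<forall>k\<le>n. S k \<omega> = x k}"
    by (intro finite_measure_mono event_all_le) auto
  then show ?thesis using True by (simp add: measure_le_0_iff)
next
  case False
  then have pos: "prob {\<omega> \<in> space M. \<forall>k\<le>n. S k \<omega> = x k} > 0"
    using measure_nonneg[of M] by (simp add: less_le)
  also have "\<dots> \<le> prob {\<omega> \<in> space M. S n \<omega> = x n}"
    by (intro finite_measure_mono) auto
  finally have pos_n: "prob {\<omega> \<in> space M. S n \<omega> = x n} > 0" .
  have "\<P>(\<omega> in M. S (Suc n) \<omega> = j \<bar> \<forall>k\<le>n. S k \<omega> = x k)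
      = \<P>(\<omega> in M. S (Suc n) \<omega> = j \<bar> S n \<omega> = x n)"
    using markov pos unfolding markov_chain_def by blast
  also have "\<dots> = P $$ (x n, j)"
    using markov dim pos_n assms unfolding markov_chain_def by auto
  finally show ?thesis
    using pos by (simp add: cond_prob_def conj_commute field_simps)
qed

text \<open>The Markov property in integrated form: the next state may be averaged over the row of
  \<open>P\<close> at the current state, even when the integrand depends on the whole history. The
  history and next state form one variable of finite range, and \<open>prob_path_Suc\<close> is
  applied path by path.\<close>

lemma expectation_step:
  fixes F :: "(nat \<Rightarrow> nat) \<Rightarrow> nat \<Rightarrow> real"
  shows "expectation (\<lambda>\<omega>. F (history n \<omega>) (S (Suc n) \<omega>))
    = expectation (\<lambda>\<omega>. \<Sum>j<d. F (history n \<omega>) j * P $$ (S n \<omega>, j))"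
proof -
  let ?C = "paths n \<times> {0..<d}"
  have "(\<lambda>\<omega>. (history n \<omega>, S (Suc n) \<omega>)) \<in> measurable M (count_space (paths n) \<Otimes>\<^sub>M count_space {0..<d})"
    by (intro measurable_Pair history_measurable state_measurable)
  also have "count_space (paths n) \<Otimes>\<^sub>M count_space {0..<d} = count_space ?C"
    by (intro pair_measure_count_space finite_paths) auto
  finally have "expectation (\<lambda>\<omega>. case_prod F (history n \<omega>, S (Suc n) \<omega>))
      = (\<Sum>z\<in>?C. case_prod F z * prob {\<omega> \<in> space M. (history n \<omega>, S (Suc n) \<omega>) = z})"
    by (rule expectation_finite_range) (simp add: finite_paths)
  also have "\<dots> = (\<Sum>x\<in>paths n. \<Sum>j<d. F x j * prob {\<omega> \<in> space M. history n \<omega> = x \<and> S (Suc n) \<omega> = j})"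
    by (simp add: sum.cartesian_product lessThan_atLeast0 case_prod_unfold prod_eq_iff)
  also have "\<dots> = (\<Sum>x\<in>paths n. (\<Sum>j<d. F x j * P $$ (x n, j)) * prob {\<omega> \<in> space M. history n \<omega> = x})"
  proof (rule sum.cong)
    fix x assume x: "x \<in> paths n"
    then have "x n < d" by (auto simp: PiE_def Pi_def)
    then show "(\<Sum>j<d. F x j * prob {\<omega> \<in> space M. history n \<omega> = x \<and> S (Suc n) \<omega> = j})
      = (\<Sum>j<d. F x j * P $$ (x n, j)) * prob {\<omega> \<in> space M. history n \<omega> = x}"
      using x by (simp add: history_eq_iff prob_path_Suc sum_distrib_left sum_distrib_right mult_ac)
  qed simp
  also have "\<dots> = expectation (\<lambda>\<omega>. \<Sum>j<d. F (history n \<omega>) j * P $$ (history n \<omega> n, j))"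
    using expectation_finite_range[OF history_measurable[of n] finite_paths,
        of "\<lambda>x. \<Sum>j<d. F x j * P $$ (x n, j)"] by simp
  finally show ?thesis by simp
qed

section \<open>Probabilities and rewards restricted to fixed endpoints\<close>

definition joint_prob :: "nat \<Rightarrow> nat \<Rightarrow> nat \<Rightarrow> real" where
  "joint_prob n i j = prob {\<omega> \<in> space M. S 0 \<omega> = i \<and> S n \<omega> = j}"

text \<open>The quantity W_n(i, j). Without normalisation it satisfies a linear recursion in which
  null events need no separate treatment.\<close>

definition joint_reward :: "real mat \<Rightarrow> nat \<Rightarrow> nat \<Rightarrow> nat \<Rightarrow> real" where
  "joint_reward \<Theta> n i j = expectation (\<lambda>\<omega>. accumulated_reward \<Theta> S n \<omega>
     * indicator {\<omega> \<in> space M. S 0 \<omega> = i \<and> S n \<omega> = j} \<omega>)"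

lemma endpoint_event [measurable]: "{\<omega> \<in> space M. S 0 \<omega> = i \<and> S n \<omega> = j} \<in> events"
proof -
  have "S k -` ({x} \<inter> {0..<d}) \<inter> space M \<in> events" for x k
    by (rule measurable_sets[OF state_measurable]) auto
  moreover have "{\<omega> \<in> space M. S 0 \<omega> = i \<and> S n \<omega> = j} =
      (S 0 -` ({i} \<inter> {0..<d}) \<inter> space M) \<inter> (S n -` ({j} \<inter> {0..<d}) \<inter> space M)"
    using state_less by auto
  ultimately show ?thesis by auto
qed

text \<open>Exhibits the accumulated reward as a function of the history, as
  \<open>expectation_step\<close> and the finite-range lemmas require.\<close>

definition path_reward :: "real mat \<Rightarrow> nat \<Rightarrow> (nat \<Rightarrow> nat) \<Rightarrow> real" where
  "path_reward \<Theta> n x = (\<Sum>k=1..n. \<Theta> $$ (x (k - 1), x k))"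

lemma path_reward_history: "path_reward \<Theta> n (history n \<omega>) = accumulated_reward \<Theta> S n \<omega>"
  by (auto simp: path_reward_def history_def accumulated_reward_def intro!: sum.cong)

lemma integrable_history: "integrable M (\<lambda>\<omega>. f (history n \<omega>) :: real)"
  by (rule integrable_finite_range[OF history_measurable finite_paths])

lemma joint_prob_expectation:
  "joint_prob n i j = expectation (\<lambda>\<omega>. if S 0 \<omega> = i \<and> S n \<omega> = j then 1 else 0)"
proof -
  have "joint_prob n i j = expectation (indicator {\<omega> \<in> space M. S 0 \<omega> = i \<and> S n \<omega> = j})"
    by (simp add: joint_prob_def)
  also have "\<dots> = expectation (\<lambda>\<omega>. if S 0 \<omega> = i \<and> S n \<omega> = j then 1 else 0)"
    by (rule Bochner_Integration.integral_cong) (auto simp: indicator_def)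
  finally show ?thesis .
qed

lemma joint_reward_expectation:
  "joint_reward \<Theta> n i j
     = expectation (\<lambda>\<omega>. if S 0 \<omega> = i \<and> S n \<omega> = j then accumulated_reward \<Theta> S n \<omega> else 0)"
  unfolding joint_reward_def
  by (rule Bochner_Integration.integral_cong) (auto simp: indicator_def)

text \<open>Common source of the recursions for probabilities and rewards: \<open>f\<close> is what
  has been collected up to time \<open>n\<close>, \<open>g\<close> what the last transition adds.
  Splitting by the value \<open>l\<close> of S_n makes the factor \<open>g l j\<close> constant on
  each piece.\<close>

lemma expectation_step_endpoints:
  assumes j: "j < d"
  shows "expectation (\<lambda>\<omega>. if S 0 \<omega> = i \<and> S (Suc n) \<omega> = j
      then f (history n \<omega>) + g (S n \<omega>) (S (Suc n) \<omega>) else 0)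
    = (\<Sum>l<d. (expectation (\<lambda>\<omega>. if S 0 \<omega> = i \<and> S n \<omega> = l then f (history n \<omega>) else 0)
        + g l j * joint_prob n i l) * P $$ (l, j))"
proof -
  define F where "F x m = (if x 0 = i \<and> m = j then f x + g (x n) m else 0)" for x :: "nat \<Rightarrow> nat" and m
  define E :: "nat \<Rightarrow> 'w \<Rightarrow> real" where
    "E l = (\<lambda>\<omega>. if S 0 \<omega> = i \<and> S n \<omega> = l then f (history n \<omega>) else 0)" for l
  define I :: "nat \<Rightarrow> 'w \<Rightarrow> real" where
    "I l = (\<lambda>\<omega>. if S 0 \<omega> = i \<and> S n \<omega> = l then 1 else 0)" for l
  have int: "integrable M (E l)" "integrable M (I l)" for l
    using integrable_history[of "\<lambda>x. if x 0 = i \<and> x n = l then f x else 0" n]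
      integrable_history[of "\<lambda>x. if x 0 = i \<and> x n = l then 1 else 0" n]
    by (simp_all add: E_def I_def)
  have "expectation (\<lambda>\<omega>. if S 0 \<omega> = i \<and> S (Suc n) \<omega> = j
      then f (history n \<omega>) + g (S n \<omega>) (S (Suc n) \<omega>) else 0)
    = expectation (\<lambda>\<omega>. \<Sum>m<d. F (history n \<omega>) m * P $$ (S n \<omega>, m))"
    using expectation_step[of F n] by (simp add: F_def cong: if_cong)
  also have "\<dots> = expectation (\<lambda>\<omega>. \<Sum>l<d. (E l \<omega> + g l j * I l \<omega>) * P $$ (l, j))"
  proof (rule Bochner_Integration.integral_cong)
    fix \<omega> assume "\<omega> \<in> space M"
    then have Sn: "S n \<omega> < d" by (rule state_less)
    have "(\<Sum>m<d. F (history n \<omega>) m * P $$ (S n \<omega>, m))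
        = (\<Sum>m<d. if m = j then F (history n \<omega>) j * P $$ (S n \<omega>, j) else 0)"
      by (intro sum.cong) (auto simp: F_def)
    \<comment> \<open>The sum over the next state has collapsed to \<open>m = j\<close>; its value
      is now spread over the possible current states \<open>l\<close>.\<close>
    also have "\<dots> = (\<Sum>l<d. if l = S n \<omega> then F (history n \<omega>) j * P $$ (l, j) else 0)"
      using j Sn by simp
    also have "\<dots> = (\<Sum>l<d. (E l \<omega> + g l j * I l \<omega>) * P $$ (l, j))"
      by (intro sum.cong) (auto simp: E_def I_def F_def)
    finally show "(\<Sum>m<d. F (history n \<omega>) m * P $$ (S n \<omega>, m))
        = (\<Sum>l<d. (E l \<omega> + g l j * I l \<omega>) * P $$ (l, j))" .
  qed simp
  also have "\<dots> = (\<Sum>l<d. (expectation (E l) + g l j * joint_prob n i l) * P $$ (l, j))"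
    using int by (simp add: joint_prob_expectation flip: I_def)
  finally show ?thesis by (simp only: E_def)
qed

lemma joint_prob_Suc:
  assumes "j < d"
  shows "joint_prob (Suc n) i j = (\<Sum>l<d. joint_prob n i l * P $$ (l, j))"
  using expectation_step_endpoints[OF assms, of i n "\<lambda>_. 1" "\<lambda>_ _. 0"]
  by (simp add: joint_prob_expectation cong: if_cong)

lemma joint_reward_Suc:
  assumes "j < d"
  shows "joint_reward \<Theta> (Suc n) i j
    = (\<Sum>l<d. (joint_reward \<Theta> n i l + \<Theta> $$ (l, j) * joint_prob n i l) * P $$ (l, j))"
  using expectation_step_endpoints[OF assms, of i n "path_reward \<Theta> n" "\<lambda>l m. \<Theta> $$ (l, m)"]
  by (simp add: joint_reward_expectation path_reward_history accumulated_reward_def cong: if_cong)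

lemma joint_prob_power:
  assumes "i < d" "j < d"
  shows "joint_prob n i j = prob {\<omega> \<in> space M. S 0 \<omega> = i} * (P ^\<^sub>m n) $$ (i, j)"
  using assms(2)
proof (induction n arbitrary: j)
  case 0
  have "{\<omega> \<in> space M. S 0 \<omega> = i \<and> S 0 \<omega> = j} = (if i = j then {\<omega> \<in> space M. S 0 \<omega> = i} else {})"
    by auto
  then show ?case using assms(1) 0 dim by (simp add: joint_prob_def)
next
  case (Suc n)
  have "(P ^\<^sub>m Suc n) $$ (i, j) = (\<Sum>l<d. (P ^\<^sub>m n) $$ (i, l) * P $$ (l, j))"
    using dim assms(1) Suc.prems by (simp add: scalar_prod_def lessThan_atLeast0)
  then show ?case
    using Suc by (simp add: joint_prob_Suc sum_distrib_left mult_ac)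
qed

text \<open>Separates probability from block algebra: any sequence \<open>T\<close> with this start
  and recursion gives the rewards up to the factor Pr(S_0 = i). The last transition contributes
  through \<open>joint_prob_power\<close>, which produces P^n times the Hadamard product.\<close>

lemma joint_reward_eq:
  assumes \<Theta>: "\<Theta> \<in> carrier_mat d d"
    and T: "\<And>n. T n \<in> carrier_mat d d" "T 0 = 0\<^sub>m d d"
      "\<And>n. T (Suc n) = T n * P + P ^\<^sub>m n * (\<Theta> \<odot> P)"
    and i: "i < d" and "j < d"
  shows "joint_reward \<Theta> n i j = prob {\<omega> \<in> space M. S 0 \<omega> = i} * T n $$ (i, j)"
  using \<open>j < d\<close>
proof (induction n arbitrary: j)
  case 0
  then show ?case using i by (simp add: joint_reward_def accumulated_reward_def T(2))
next
  case (Suc n)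
  have "T (Suc n) $$ (i, j) = (\<Sum>l<d. T n $$ (i, l) * P $$ (l, j))
      + (\<Sum>l<d. (P ^\<^sub>m n) $$ (i, l) * (\<Theta> $$ (l, j) * P $$ (l, j)))"
    using dim \<Theta> T(1)[of n] i Suc.prems
    by (simp add: T(3) hadamard_mat_def scalar_prod_def lessThan_atLeast0)
  then show ?case
    using Suc i by (simp add: joint_reward_Suc joint_prob_power sum_distrib_left
        sum.distrib distrib_left distrib_right mult_ac)
qed

text \<open>For an endpoint event of positive probability, that probability cancels between the
  conditional expectation and the weight. For a null event the convention gives 0, as does the
  integral over it.\<close>

lemma weighted_reward_entry:
  assumes "prob {\<omega> \<in> space M. S 0 \<omega> = i} > 0"
  shows "(if \<P>(\<omega> in M. S n \<omega> = j \<bar> S 0 \<omega> = i) = 0 then 0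
      else cond_expectation M (accumulated_reward \<Theta> S n) {\<omega> \<in> space M. S 0 \<omega> = i \<and> S n \<omega> = j}
        * \<P>(\<omega> in M. S n \<omega> = j \<bar> S 0 \<omega> = i))
    = joint_reward \<Theta> n i j / prob {\<omega> \<in> space M. S 0 \<omega> = i}"
proof -
  let ?A = "{\<omega> \<in> space M. S 0 \<omega> = i \<and> S n \<omega> = j}"
  have cond: "\<P>(\<omega> in M. S n \<omega> = j \<bar> S 0 \<omega> = i) = prob ?A / prob {\<omega> \<in> space M. S 0 \<omega> = i}"
    by (simp add: cond_prob_def conj_commute)
  show ?thesis
  proof (cases "prob ?A = 0")
    case True
    then have "AE \<omega> in M. \<omega> \<notin> ?A"
      using prob_eq_0[OF endpoint_event] by simp
    moreover have "integrable M (\<lambda>\<omega>. if S 0 \<omega> = i \<and> S n \<omega> = j then accumulated_reward \<Theta> S n \<omega> else 0)"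
      using integrable_history[of "\<lambda>x. if x 0 = i \<and> x n = j then path_reward \<Theta> n x else 0" n]
      by (simp add: path_reward_history cong: if_cong)
    ultimately have "joint_reward \<Theta> n i j = expectation (\<lambda>_. 0)"
      unfolding joint_reward_expectation
      by (intro integral_cong_AE) (auto elim!: eventually_mono)
    then show ?thesis by (simp add: cond True)
  next
    case False
    have "accumulated_reward \<Theta> S n \<in> borel_measurable M"
      using integrable_history[of "path_reward \<Theta> n" n]
      by (simp add: path_reward_history borel_measurable_integrable)
    then have "cond_expectation M (accumulated_reward \<Theta> S n) ?A = joint_reward \<Theta> n i j / prob ?A"
      unfolding cond_expectation_def joint_reward_def
      by (intro integral_uniform_measure) (use False in \<open>auto simp: emeasure_eq_measure\<close>)
    then show ?thesis using False assms by (simp add: cond)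
  qed
qed

end

section \<open>Identification of the weighted reward matrix with the block matrix\<close>

theorem lemma10:
  fixes t a n :: nat
    and P Q R \<Theta> \<Theta>\<^sub>1 \<Theta>\<^sub>2 H\<^sub>1 H\<^sub>2 N :: "real mat"
    and M :: "nat \<Rightarrow> 'w measure" and S :: "nat \<Rightarrow> 'w \<Rightarrow> nat"
  assumes Q: "Q \<in> carrier_mat t t" and R: "R \<in> carrier_mat t a"
    and P: "P = four_block_mat Q R (0\<^sub>m a t) (1\<^sub>m a)"
    and absorbing: "absorbing_chain P"
    and canonical: "transient_states P = {0..<t}" "absorbing_states P = {t..<t + a}"
    and chain: "\<And>i. i < t + a \<Longrightarrow> markov_chain (M i) S P"
    and initial: "\<And>i. i < t + a \<Longrightarrow> \<P>(\<omega> in M i. S 0 \<omega> = i) > 0"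
    and \<Theta>12: "\<Theta>\<^sub>1 \<in> carrier_mat t t" "\<Theta>\<^sub>2 \<in> carrier_mat t a"
    and \<Theta>: "\<Theta> = four_block_mat \<Theta>\<^sub>1 \<Theta>\<^sub>2 (0\<^sub>m a t) (0\<^sub>m a a)"
    and H12: "H\<^sub>1 \<in> carrier_mat t t" "H\<^sub>2 \<in> carrier_mat t a"
    and H: "\<Theta> \<odot> P = four_block_mat H\<^sub>1 H\<^sub>2 (0\<^sub>m a t) (0\<^sub>m a a)"
    and N: "N = fundamental_matrix Q"
    and n: "n \<ge> 1"
  shows "weighted_reward_mat M S \<Theta> n =
    four_block_mat
      (mat_sum t t (\<lambda>i. Q ^\<^sub>m i * H\<^sub>1 * Q ^\<^sub>m (n - i - 1)) {0..<n})
      (N * (1\<^sub>m t - Q ^\<^sub>m n) * H\<^sub>2 + N * (1\<^sub>m t - Q ^\<^sub>m (n - 1)) * H\<^sub>1 * N * R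
        - mat_sum t a (\<lambda>i. Q ^\<^sub>m i * H\<^sub>1 * N * Q ^\<^sub>m (n - i - 1) * R) {0..<n - 1})
      (0\<^sub>m a t)
      (0\<^sub>m a a)"
proof -
  have Pc: "P \<in> carrier_mat (t + a) (t + a)"
    using Q by (simp add: P)
  have \<Theta>c: "\<Theta> \<in> carrier_mat (t + a) (t + a)"
    using \<Theta>12 by (simp add: \<Theta>)
  note inverse = fundamental_matrix_inverse[OF Q R P absorbing canonical, folded N]
  \<comment> \<open>The regrouped form is used throughout because its recursion starts at 0; it is
    converted to the stated form only at the end, where \<open>n \<ge> 1\<close> enters.\<close>
  let ?T = "reward_block Q R H\<^sub>1 H\<^sub>2 N"
  have T_carrier: "?T m \<in> carrier_mat (t + a) (t + a)" for m
    using Q R by (simp add: reward_block_def)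
  note T_0 = reward_block_0[OF Q R H12 inverse]
  \<comment> \<open>\<open>H\<close> speaks of \<Theta> \<odot> P with \<open>P\<close> folded, so
    it has to be rewritten before \<open>P\<close> is unfolded.\<close>
  have T_Suc: "?T (Suc m) = ?T m * P + P ^\<^sub>m m * (\<Theta> \<odot> P)" for m
    unfolding H unfolding P by (rule reward_block_Suc[OF Q R H12 inverse])
  have "weighted_reward_mat M S \<Theta> n = ?T n"
  proof (rule eq_matI)
    show "dim_row (weighted_reward_mat M S \<Theta> n) = dim_row (?T n)"
      "dim_col (weighted_reward_mat M S \<Theta> n) = dim_col (?T n)"
      using \<Theta>c T_carrier[of n] by (auto simp: weighted_reward_mat_def)
    fix i j assume "i < dim_row (?T n)" "j < dim_col (?T n)"
    then have i: "i < t + a" and j: "j < t + a"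
      using T_carrier[of n] by auto
    \<comment> \<open>Row \<open>i\<close> is computed under its own law \<open>M i\<close>, where
      Pr(S_0 = i) is positive and cancels.\<close>
    interpret discrete_markov_chain "M i" S P "t + a"
      by unfold_locales (fact chain[OF i], fact Pc)
    have "weighted_reward_mat M S \<Theta> n $$ (i, j)
        = joint_reward \<Theta> n i j / prob {\<omega> \<in> space (M i). S 0 \<omega> = i}"
      using i j \<Theta>c weighted_reward_entry[OF initial[OF i], of n j \<Theta>]
      by (simp only: weighted_reward_mat_def mean_reward_def carrier_matD index_mat prod.case)
    also have "\<dots> = ?T n $$ (i, j)"
      using joint_reward_eq[OF \<Theta>c T_carrier T_0 T_Suc i j] initial[OF i] by simp
    finally show "weighted_reward_mat M S \<Theta> n $$ (i, j) = ?T n $$ (i, j)" .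
  qed
  then show ?thesis
    using Q R by (simp only: reward_block_def reward_power_sum_def carrier_matD
        absorbing_reward_eq[OF Q R H12 inverse n])
qed

end
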